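(* Let $M$ be a lattice of finite rank with dual lattice $N$, let $\sigma\subset N_{\mathbb{Q}}$ be a strongly convex rational polyhedral cone with dual cone $\sigma^\vee\subset M_{\mathbb{Q}}$, and let $X=\operatorname{Spec}(A)$ with $A=\bigoplus_{u\in\sigma^\vee\cap M}\mathbb{C}\cdot\chi^u$ be the corresponding affine toric variety with torus $T=\operatorname{Spec}\mathbb{C}[M]$. Let $\{u_1,\dots,u_k\}$ be a minimal generating set of $\sigma^\vee\cap M$. Then the collection of all sets of semistable points is $$\{X^{ss}(u) : u\in\sigma^\vee\cap M\}=\{X^{ss}(u) : u=\alpha_1u_1+\alpha_2u_2+\dots+\alpha_ku_k,\ \alpha_i\in\{0,1\}\}.$$
   Context: For an $M$-graded algebra $A=\bigoplus_{u\in M}A_u$ and $X=\operatorname{Spec}(A)$, the set of semistable points associated to $u\in M$ (that is, to the $T$-linearization of the trivial line bundle given by the character $\chi^u$) is $X^{ss}(u)=\bigcup_{n\in\mathbb{Z}_{>0},\,f\in A_{nu}}X_f$, where $X_f=\{x\in X: f(x)\neq0\}$. *)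

theory Defs
  imports Complex_Main "HOL-Library.Poly_Mapping" "HOL-Algebra.Ideal"
begin

section \<open>Lattices, dual lattices and cones\<close>

text \<open>
  The vector space \<open>M\<^sub>\<rat>\<close> is a finite-dimensional rational vector space on the type \<open>'v\<close>, with scalar
  multiplication \<open>scale\<close>, and the lattice \<open>M\<close> is the \<open>\<int>\<close>-span of one of its bases. The basis may
  be empty (rank 0).
\<close>

definition lattice_in :: "(rat \<Rightarrow> 'v \<Rightarrow> 'v) \<Rightarrow> 'v::ab_group_add set \<Rightarrow> bool" where
  "lattice_in scale M \<longleftrightarrow>
     (\<exists>B. finite_dimensional_vector_space scale B \<and>
          M = {\<Sum>b\<in>B. scale (of_int (c b)) b | c :: 'v \<Rightarrow> int. True})"

text \<open>
  \<open>N\<^sub>\<rat>\<close> is realised as the space of linear functionals on \<open>M\<^sub>\<rat>\<close>, so that the pairing of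
  \<open>v \<in> N\<^sub>\<rat>\<close> with \<open>x \<in> M\<^sub>\<rat>\<close> is \<open>v x\<close>. The dual lattice \<open>N = Hom(M, \<int>)\<close> consists of the functionals
  that are integral on \<open>M\<close>.
\<close>

definition dual_lattice :: "(rat \<Rightarrow> 'v \<Rightarrow> 'v) \<Rightarrow> 'v::ab_group_add set \<Rightarrow> ('v \<Rightarrow> rat) set" where
  "dual_lattice scale M = {v. Vector_Spaces.linear scale (*) v \<and> v ` M \<subseteq> \<int>}"

definition rational_polyhedral_cone ::
    "(rat \<Rightarrow> 'v \<Rightarrow> 'v) \<Rightarrow> 'v::ab_group_add set \<Rightarrow> ('v \<Rightarrow> rat) set \<Rightarrow> bool" where
  "rational_polyhedral_cone scale M \<sigma> \<longleftrightarrow>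
     (\<exists>S. finite S \<and> S \<subseteq> dual_lattice scale M \<and>
          \<sigma> = {(\<lambda>x. \<Sum>v\<in>S. r v * v x) | r. \<forall>v\<in>S. 0 \<le> r v})"

definition strongly_convex :: "('v \<Rightarrow> rat) set \<Rightarrow> bool" where
  "strongly_convex \<sigma> \<longleftrightarrow> \<sigma> \<inter> uminus ` \<sigma> = {\<lambda>_. 0}"

definition dual_cone :: "('v \<Rightarrow> rat) set \<Rightarrow> 'v set" where
  "dual_cone \<sigma> = {x. \<forall>v\<in>\<sigma>. 0 \<le> v x}"


section \<open>Generating sets of commutative monoids\<close>

inductive_set monoid_span :: "'v::comm_monoid_add set \<Rightarrow> 'v set" for G where
  zero: "0 \<in> monoid_span G"
| add: "\<lbrakk>g \<in> G; x \<in> monoid_span G\<rbrakk> \<Longrightarrow> g + x \<in> monoid_span G"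

definition minimal_generating_set :: "'v::comm_monoid_add set \<Rightarrow> 'v set \<Rightarrow> bool" where
  "minimal_generating_set G S \<longleftrightarrow>
     monoid_span G = S \<and> (\<forall>H. H \<subset> G \<longrightarrow> monoid_span H \<noteq> S)"


section \<open>Spectra and semistable points\<close>

definition Spec :: "('a, 'b) ring_scheme \<Rightarrow> 'a set set" where
  "Spec R = {P. primeideal P R}"

text \<open>
  For a point \<open>x\<close> of \<open>Spec R\<close>, i.e. a prime ideal \<open>P\<close>, the value \<open>f(x)\<close> is the class of \<open>f\<close> in the
  residue field at \<open>P\<close>; hence \<open>f(x) \<noteq> 0\<close> means \<open>f \<notin> P\<close>.
\<close>

definition basic_open :: "('a, 'b) ring_scheme \<Rightarrow> 'a \<Rightarrow> 'a set set" where
  "basic_open R f = {P \<in> Spec R. f \<notin> P}"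

text \<open>
  \<open>Gr w\<close> is the homogeneous component of degree \<open>w\<close> of the graded ring \<open>R\<close>.
\<close>

definition semistable_points ::
    "(rat \<Rightarrow> 'v \<Rightarrow> 'v) \<Rightarrow> ('a, 'b) ring_scheme \<Rightarrow> ('v \<Rightarrow> 'a set) \<Rightarrow> 'v \<Rightarrow> 'a set set" where
  "semistable_points scale R Gr u =
     (\<Union>n\<in>{n::nat. 0 < n}. \<Union>f\<in>Gr (scale (of_nat n) u). basic_open R f)"


section \<open>The coordinate ring of an affine toric variety\<close>

text \<open>
  Multiplication on \<open>'v \<Rightarrow>\<^sub>0 complex\<close> is convolution, so this type is the group algebra of \<open>'v\<close>, with
  \<open>Poly_Mapping.single u 1\<close> in the role of \<open>\<chi>\<^sup>u\<close>. The algebra of a submonoid \<open>S\<close> consists of the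
  elements supported in \<open>S\<close>.
\<close>

definition monoid_algebra :: "'v::ab_group_add set \<Rightarrow> ('v \<Rightarrow>\<^sub>0 complex) ring" where
  "monoid_algebra S =
     \<lparr>carrier = {f. Poly_Mapping.keys f \<subseteq> S}, monoid.mult = (*), one = 1, ring.zero = 0, add = (+)\<rparr>"

definition monoid_algebra_component ::
    "'v::ab_group_add set \<Rightarrow> 'v \<Rightarrow> ('v \<Rightarrow>\<^sub>0 complex) set" where
  "monoid_algebra_component S w = {f \<in> carrier (monoid_algebra S). Poly_Mapping.keys f \<subseteq> {w}}"

definition toric_semistable_points ::
    "(rat \<Rightarrow> 'v \<Rightarrow> 'v) \<Rightarrow> 'v::ab_group_add set \<Rightarrow> ('v \<Rightarrow> rat) set \<Rightarrow> 'v \<Rightarrow> ('v \<Rightarrow>\<^sub>0 complex) set set" where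
  "toric_semistable_points scale M \<sigma> =
     semistable_points scale (monoid_algebra (dual_cone \<sigma> \<inter> M))
       (monoid_algebra_component (dual_cone \<sigma> \<inter> M))"

lemma monoid_algebra_component_eq:
  "monoid_algebra_component S w =
     (if w \<in> S then range (\<lambda>c. Poly_Mapping.single w c) else {0})"
proof (cases "w \<in> S")
  case True
  have "f = Poly_Mapping.single w (Poly_Mapping.lookup f w)" if "Poly_Mapping.keys f \<subseteq> {w}"
    for f :: "'a \<Rightarrow>\<^sub>0 complex"
    using that by (intro poly_mapping_eqI) (auto simp: lookup_single when_def in_keys_iff)
  with True show ?thesis
    by (auto simp: monoid_algebra_component_def monoid_algebra_def split: if_splits)
next
  case False
  have "f = 0" if "Poly_Mapping.keys f \<subseteq> S" "Poly_Mapping.keys f \<subseteq> {w}" for f :: "'a \<Rightarrow>\<^sub>0 complex"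
    using that False by (metis empty_iff insert_iff keys_eq_empty subset_empty subset_iff subsetI)
  with False show ?thesis
    by (auto simp: monoid_algebra_component_def monoid_algebra_def)
qed

lemma cring_monoid_algebra:
  assumes "0 \<in> S" and "\<And>x y. x \<in> S \<Longrightarrow> y \<in> S \<Longrightarrow> x + y \<in> S"
  shows "cring (monoid_algebra S)"
proof (intro cringI abelian_groupI comm_monoidI)
  fix x y :: "'a \<Rightarrow>\<^sub>0 complex"
  assume "x \<in> carrier (monoid_algebra S)" "y \<in> carrier (monoid_algebra S)"
  then have x: "Poly_Mapping.keys x \<subseteq> S" and y: "Poly_Mapping.keys y \<subseteq> S"
    by (auto simp: monoid_algebra_def)
  show "x \<oplus>\<^bsub>monoid_algebra S\<^esub> y \<in> carrier (monoid_algebra S)"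
    using x y Poly_Mapping.keys_add[of x y] by (auto simp: monoid_algebra_def)
  show "x \<otimes>\<^bsub>monoid_algebra S\<^esub> y \<in> carrier (monoid_algebra S)"
    using x y keys_mult[of x y] assms(2) by (fastforce simp: monoid_algebra_def)
next
  fix x :: "'a \<Rightarrow>\<^sub>0 complex"
  assume "x \<in> carrier (monoid_algebra S)"
  then show "\<exists>y\<in>carrier (monoid_algebra S). y \<oplus>\<^bsub>monoid_algebra S\<^esub> x = \<zero>\<^bsub>monoid_algebra S\<^esub>"
    by (intro bexI[of _ "- x"]) (auto simp: monoid_algebra_def)
qed (use assms(1) in \<open>auto simp: monoid_algebra_def algebra_simps\<close>)

end

theory Submission
  imports Defs
begin

text \<open>
  Let \<open>S = \<sigma>\<^sup>\<or> \<inter> M\<close>. Each nonzero graded piece of the coordinate ring is spanned by one monomial, and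
  \<open>\<chi>\<^sup>n\<^sup>w\<close> is the \<open>n\<close>-th power of \<open>\<chi>\<^sup>w\<close>; since a prime contains a power only if it contains the base,
  the semistable set of \<open>w \<in> S\<close> is the single basic open set where \<open>\<chi>\<^sup>w\<close> does not vanish
  (\<open>toric_semistable_points_iff\<close>).

  For a point \<open>P\<close>, the degrees \<open>w \<in> S\<close> with \<open>\<chi>\<^sup>w \<notin> P\<close> form a face of the monoid \<open>S\<close>: a submonoid that
  contains a sum of elements of \<open>S\<close> only if it contains the summands. So \<open>\<Sum>\<^sub>i a\<^sub>i u\<^sub>i\<close> lies in it
  exactly when it contains every \<open>u\<^sub>i\<close> with \<open>a\<^sub>i \<noteq> 0\<close> (\<open>nonvanishing_degrees_combination_iff\<close>). Hence
  the semistable set depends only on the support of the coefficient vector, and all positive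
  coefficients may be replaced by \<open>1\<close>.
\<close>

lemma monoid_span_base: "g \<in> G \<Longrightarrow> g \<in> monoid_span G"
  using monoid_span.add[OF _ monoid_span.zero] by force

lemma monoid_span_add_closed:
  assumes "x \<in> monoid_span G" "y \<in> monoid_span G"
  shows "x + y \<in> monoid_span G"
  using assms by (induction rule: monoid_span.induct) (auto simp: add.assoc intro: monoid_span.intros)

lemma monoid_span_combination:
  assumes "vector_space (scale :: rat \<Rightarrow> 'v::ab_group_add \<Rightarrow> 'v)"
    and "finite I" and "w \<in> monoid_span (u ` I)"
  shows "\<exists>a :: 'i \<Rightarrow> nat. w = (\<Sum>i\<in>I. scale (of_nat (a i)) (u i))"
  using assms(3)
proof (induction rule: monoid_span.induct)
  interpret vector_space scale by fact
  case zero
  show ?case by (intro exI[of _ "\<lambda>_. 0"]) simp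
next
  interpret vector_space scale by fact
  case (add g x)
  then obtain a j where a: "x = (\<Sum>i\<in>I. scale (of_nat (a i)) (u i))" and j: "j \<in> I" "g = u j"
    by blast
  have "(\<Sum>i\<in>I. scale (of_nat ((a(j := Suc (a j))) i)) (u i))
      = (\<Sum>i\<in>I. (if i = j then u i else 0) + scale (of_nat (a i)) (u i))"
    by (intro sum.cong) (auto simp: scale_left_distrib)
  also have "\<dots> = g + x"
    using \<open>finite I\<close> j by (simp add: sum.distrib a)
  finally show ?case by metis
qed

lemma multiple_in_submonoid:
  assumes "vector_space (scale :: rat \<Rightarrow> 'v::ab_group_add \<Rightarrow> 'v)"
    and "0 \<in> S" "\<And>x y. x \<in> S \<Longrightarrow> y \<in> S \<Longrightarrow> x + y \<in> S" and "w \<in> S"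
  shows "scale (of_nat n) w \<in> S"
proof -
  interpret vector_space scale by fact
  show ?thesis
    using assms(2-4) by (induction n) (auto simp: scale_left_distrib)
qed

lemma combination_in_submonoid:
  fixes a :: "'i \<Rightarrow> nat"
  assumes "vector_space (scale :: rat \<Rightarrow> 'v::ab_group_add \<Rightarrow> 'v)"
    and "0 \<in> S" "\<And>x y. x \<in> S \<Longrightarrow> y \<in> S \<Longrightarrow> x + y \<in> S" and "\<And>i. i \<in> I \<Longrightarrow> u i \<in> S"
  shows "(\<Sum>i\<in>I. scale (of_nat (a i)) (u i)) \<in> S"
  using assms(4)
proof (induction I rule: infinite_finite_induct)
  case (insert j I)
  then show ?case
    using multiple_in_submonoid[OF assms(1-3), of "u j" "a j"] assms(3) by simp
qed (use assms(2) in simp_all)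

definition nonvanishing_degrees :: "('v::ab_group_add \<Rightarrow>\<^sub>0 complex) set \<Rightarrow> 'v set" where
  "nonvanishing_degrees P = {w. Poly_Mapping.single w 1 \<notin> P}"

text \<open>
  Here \<open>\<chi>\<^sup>x\<^sup>+\<^sup>y = \<chi>\<^sup>x \<chi>\<^sup>y\<close>: one direction holds because \<open>P\<close> is prime, the other because it is an ideal.
  Together they are the face property of the nonvanishing degrees in \<open>S\<close>.
\<close>

lemma nonvanishing_degrees_add_iff:
  assumes P: "primeideal P (monoid_algebra S)" and "x \<in> S" "y \<in> S"
  shows "x + y \<in> nonvanishing_degrees P \<longleftrightarrow> x \<in> nonvanishing_degrees P \<and> y \<in> nonvanishing_degrees P"
proof -
  interpret primeideal P "monoid_algebra S" by fact
  let ?x = "Poly_Mapping.single x (1::complex)" and ?y = "Poly_Mapping.single y (1::complex)"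
  have xy: "?x \<in> carrier (monoid_algebra S)" "?y \<in> carrier (monoid_algebra S)"
    using assms by (auto simp: monoid_algebra_def)
  have mult: "?x \<otimes>\<^bsub>monoid_algebra S\<^esub> ?y = Poly_Mapping.single (x + y) 1"
    by (simp add: monoid_algebra_def mult_single)
  show ?thesis
    using I_prime[OF xy] I_r_closed[of ?x ?y] I_l_closed[of ?y ?x] xy
    unfolding mult nonvanishing_degrees_def by blast
qed

lemma zero_in_nonvanishing_degrees:
  assumes P: "primeideal P (monoid_algebra S)"
  shows "0 \<in> nonvanishing_degrees P"
proof -
  interpret primeideal P "monoid_algebra S" by fact
  show ?thesis
    using one_imp_carrier I_notcarr by (auto simp: nonvanishing_degrees_def monoid_algebra_def)
qed

lemma nonvanishing_degrees_multiple_iff: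
  assumes vs: "vector_space (scale :: rat \<Rightarrow> 'v::ab_group_add \<Rightarrow> 'v)"
    and P: "primeideal P (monoid_algebra S)"
    and S: "0 \<in> S" "\<And>x y. x \<in> S \<Longrightarrow> y \<in> S \<Longrightarrow> x + y \<in> S"
    and w: "w \<in> S"
  shows "scale (of_nat n) w \<in> nonvanishing_degrees P \<longleftrightarrow> n = 0 \<or> w \<in> nonvanishing_degrees P"
proof -
  interpret vector_space scale by fact
  show ?thesis
  proof (induction n)
    case 0
    show ?case using zero_in_nonvanishing_degrees[OF P] by simp
  next
    case (Suc n)
    then show ?case
      using nonvanishing_degrees_add_iff[OF P w multiple_in_submonoid[OF vs S w, of n]]
      by (auto simp: scale_left_distrib)
  qed
qed

lemma nonvanishing_degrees_combination_iff:
  fixes a :: "'i \<Rightarrow> nat"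
  assumes vs: "vector_space (scale :: rat \<Rightarrow> 'v::ab_group_add \<Rightarrow> 'v)"
    and P: "primeideal P (monoid_algebra S)"
    and S: "0 \<in> S" "\<And>x y. x \<in> S \<Longrightarrow> y \<in> S \<Longrightarrow> x + y \<in> S"
    and "finite I" and "\<And>i. i \<in> I \<Longrightarrow> u i \<in> S"
  shows "(\<Sum>i\<in>I. scale (of_nat (a i)) (u i)) \<in> nonvanishing_degrees P \<longleftrightarrow>
    (\<forall>i\<in>I. a i \<noteq> 0 \<longrightarrow> u i \<in> nonvanishing_degrees P)"
  using assms(5,6)
proof (induction rule: finite_induct)
  case empty
  show ?case using zero_in_nonvanishing_degrees[OF P] by simp
next
  case (insert j I)
  have j: "u j \<in> S" and I: "\<And>i. i \<in> I \<Longrightarrow> u i \<in> S" using insert.prems by auto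
  show ?case
    using nonvanishing_degrees_add_iff[OF P multiple_in_submonoid[OF vs S j, of "a j"]
        combination_in_submonoid[OF vs S I, where I = I and a = a]]
      nonvanishing_degrees_multiple_iff[OF vs P S j, of "a j"] insert.IH[OF I] insert.hyps
    by auto
qed

text \<open>
  A nonzero section of degree \<open>nw\<close> is a constant multiple of \<open>\<chi>\<^sup>n\<^sup>w\<close>, so if it is nonzero at \<open>P\<close> then so
  are \<open>\<chi>\<^sup>n\<^sup>w\<close> and \<open>\<chi>\<^sup>w\<close>; conversely \<open>\<chi>\<^sup>w\<close> itself is a section with \<open>n = 1\<close>.
\<close>

lemma toric_semistable_points_iff:
  fixes scale :: "rat \<Rightarrow> 'v::ab_group_add \<Rightarrow> 'v"
  assumes vs: "vector_space scale"
    and S: "0 \<in> dual_cone \<sigma> \<inter> M"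
      "\<And>x y. x \<in> dual_cone \<sigma> \<inter> M \<Longrightarrow> y \<in> dual_cone \<sigma> \<inter> M \<Longrightarrow> x + y \<in> dual_cone \<sigma> \<inter> M"
    and w: "w \<in> dual_cone \<sigma> \<inter> M"
  shows "P \<in> toric_semistable_points scale M \<sigma> w \<longleftrightarrow>
    primeideal P (monoid_algebra (dual_cone \<sigma> \<inter> M)) \<and> w \<in> nonvanishing_degrees P"
proof (cases "primeideal P (monoid_algebra (dual_cone \<sigma> \<inter> M))")
  case False
  then show ?thesis
    by (auto simp: toric_semistable_points_def semistable_points_def basic_open_def Spec_def)
next
  case P: True
  let ?A = "monoid_algebra (dual_cone \<sigma> \<inter> M)"
  interpret vector_space scale by (fact vs)
  interpret P: primeideal P ?A by (fact P)
  note multiple = nonvanishing_degrees_multiple_iff[OF vs P S w]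
  have section_nonvanishing: "w \<in> nonvanishing_degrees P"
    if "n > 0" and "Poly_Mapping.single (scale (of_nat n) w) c \<notin> P" for n c
  proof (rule ccontr)
    assume "w \<notin> nonvanishing_degrees P"
    then have "Poly_Mapping.single (scale (of_nat n) w) 1 \<in> P"
      using multiple[of n] \<open>n > 0\<close> by (auto simp: nonvanishing_degrees_def)
    moreover have "Poly_Mapping.single 0 c \<in> carrier ?A"
      using S(1) by (auto simp: monoid_algebra_def)
    ultimately have "Poly_Mapping.single 0 c \<otimes>\<^bsub>?A\<^esub> Poly_Mapping.single (scale (of_nat n) w) 1 \<in> P"
      by (rule P.I_l_closed)
    with that(2) show False by (simp add: monoid_algebra_def mult_single)
  qed
  have "P \<in> toric_semistable_points scale M \<sigma> w \<longleftrightarrow>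
      (\<exists>n>0. \<exists>c. Poly_Mapping.single (scale (of_nat n) w) c \<notin> P)"
    using P multiple_in_submonoid[OF vs S w]
    by (auto simp: toric_semistable_points_def semistable_points_def basic_open_def Spec_def
        monoid_algebra_component_eq)
  also have "\<dots> \<longleftrightarrow> w \<in> nonvanishing_degrees P"
  proof
    assume "w \<in> nonvanishing_degrees P"
    then have "Poly_Mapping.single (scale (of_nat 1) w) 1 \<notin> P"
      by (simp add: nonvanishing_degrees_def)
    then show "\<exists>n>0. \<exists>c. Poly_Mapping.single (scale (of_nat n) w) c \<notin> P"
      using zero_less_one by blast
  qed (use section_nonvanishing in blast)
  finally show ?thesis using P by simp
qed

theorem lemma1:
  fixes scale :: "rat \<Rightarrow> 'v::ab_group_add \<Rightarrow> 'v"
    and M :: "'v set"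
    and \<sigma> :: "('v \<Rightarrow> rat) set"
    and k :: nat
    and u :: "nat \<Rightarrow> 'v"
  assumes "lattice_in scale M"
    and "rational_polyhedral_cone scale M \<sigma>"
    and "strongly_convex \<sigma>"
    and "inj_on u {1..k}"
    and "minimal_generating_set (u ` {1..k}) (dual_cone \<sigma> \<inter> M)"
  shows "{toric_semistable_points scale M \<sigma> w | w. w \<in> dual_cone \<sigma> \<inter> M} =
         {toric_semistable_points scale M \<sigma> w | w.
            \<exists>\<alpha> :: nat \<Rightarrow> nat. (\<forall>i\<in>{1..k}. \<alpha> i \<in> {0, 1}) \<and>
              w = (\<Sum>i\<in>{1..k}. scale (of_nat (\<alpha> i)) (u i))}"
proof -
  have vs: "vector_space scale"
    using assms(1) by (auto simp: lattice_in_def finite_dimensional_vector_space_def)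
  have span: "dual_cone \<sigma> \<inter> M = monoid_span (u ` {1..k})"
    using assms(5) by (simp add: minimal_generating_set_def)
  have S: "0 \<in> dual_cone \<sigma> \<inter> M"
    "\<And>x y. x \<in> dual_cone \<sigma> \<inter> M \<Longrightarrow> y \<in> dual_cone \<sigma> \<inter> M \<Longrightarrow> x + y \<in> dual_cone \<sigma> \<inter> M"
    unfolding span by (simp_all add: monoid_span.zero monoid_span_add_closed)
  have u: "u i \<in> dual_cone \<sigma> \<inter> M" if "i \<in> {1..k}" for i
    unfolding span using that by (intro monoid_span_base) simp
  define comb where "comb a = (\<Sum>i\<in>{1..k}. scale (of_nat (a i)) (u i))" for a :: "nat \<Rightarrow> nat"
  have comb_in: "comb a \<in> dual_cone \<sigma> \<inter> M" for a
    unfolding comb_def by (rule combination_in_submonoid[OF vs S u])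
  have semistable_comb: "P \<in> toric_semistable_points scale M \<sigma> (comb a) \<longleftrightarrow>
      primeideal P (monoid_algebra (dual_cone \<sigma> \<inter> M)) \<and>
      (\<forall>i\<in>{1..k}. a i \<noteq> 0 \<longrightarrow> u i \<in> nonvanishing_degrees P)" for P a
    using toric_semistable_points_iff[OF vs S comb_in, of P a]
      nonvanishing_degrees_combination_iff[OF vs _ S finite_atLeastAtMost u, of P 1 k "\<lambda>i. i" a]
    unfolding comb_def by blast
  show ?thesis
  proof (intro equalityI subsetI)
    fix X
    assume "X \<in> {toric_semistable_points scale M \<sigma> w | w. w \<in> dual_cone \<sigma> \<inter> M}"
    then obtain w where w: "w \<in> dual_cone \<sigma> \<inter> M" "X = toric_semistable_points scale M \<sigma> w"
      by blast
    obtain a where a: "w = comb a"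
      using monoid_span_combination[OF vs, of "{1..k}" w u] w(1) unfolding span comb_def by auto
    define \<alpha> :: "nat \<Rightarrow> nat" where "\<alpha> i = (if a i = 0 then 0 else 1)" for i
    have \<alpha>: "\<forall>i\<in>{1..k}. \<alpha> i \<in> {0, 1}" by (simp add: \<alpha>_def)
    have "X = toric_semistable_points scale M \<sigma> (comb \<alpha>)"
      unfolding w(2) a
      by (auto simp: semistable_comb \<alpha>_def)
    with \<alpha> show "X \<in> {toric_semistable_points scale M \<sigma> w | w.
            \<exists>\<alpha> :: nat \<Rightarrow> nat. (\<forall>i\<in>{1..k}. \<alpha> i \<in> {0, 1}) \<and>
              w = (\<Sum>i\<in>{1..k}. scale (of_nat (\<alpha> i)) (u i))}"
      unfolding comb_def by blast
  next
    fix X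
    assume "X \<in> {toric_semistable_points scale M \<sigma> w | w.
            \<exists>\<alpha> :: nat \<Rightarrow> nat. (\<forall>i\<in>{1..k}. \<alpha> i \<in> {0, 1}) \<and>
              w = (\<Sum>i\<in>{1..k}. scale (of_nat (\<alpha> i)) (u i))}"
    then show "X \<in> {toric_semistable_points scale M \<sigma> w | w. w \<in> dual_cone \<sigma> \<inter> M}"
      using comb_in unfolding comb_def by blast
  qed
qed

end
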